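(* Let $\mathcal{A}$ be a unital $C^*$-algebra and let $\mathcal{H}$ be a Hilbert space. Let $\varphi:\mathcal{A}\to\mathscr{B}(\mathcal{H})$ and $\psi:\mathcal{A}\to\mathscr{B}(\mathcal{H})$ be completely positive maps, where $\varphi$ is quasi-pure and $\varphi(I)=\psi(I)$. Suppose $R\in\mathscr{B}(\mathcal{H})$ is such that $$\varphi(X)R=\psi(X)R\quad\text{for all } X\in\mathcal{A}.$$ Assume that there exists $X_0\in\mathcal{A}$ such that $\varphi(X_0)R\neq 0$. Then $\varphi=\psi$.
   Context: $I$ denotes the unit of $\mathcal{A}$. For a completely positive (CP) map $\varphi:\mathcal{A}\to\mathscr{B}(\mathcal{H})$, a minimal Stinespring triple $(\mathcal{K},\pi,V)$ consists of a Hilbert space $\mathcal{K}$, a unital $*$-representation $\pi:\mathcal{A}\to\mathscr{B}(\mathcal{K})$ and a bounded linear map $V:\mathcal{H}\to\mathcal{K}$ such that $\varphi(X)=V^*\pi(X)V$ for all $X\in\mathcal{A}$ and $\overline{\mathrm{span}}\{\pi(X)Vh: X\in\mathcal{A},h\in\mathcal{H}\}=\mathcal{K}$. The CP map $\varphi$ is called quasi-pure if every non-zero vector in the range of $V$ is cyclic for $\pi$, that is, $\mathcal{K}=\overline{\mathrm{span}}\{\pi(X)g: X\in\mathcal{A}\}$ for every $0\neq g\in V(\mathcal{H})$. *)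

theory Defs
  imports "HOL-Analysis.Analysis"
begin

section \<open>Complex vector spaces, Hilbert spaces and unital C*-algebras\<close>

text \<open>The axiom \<open>scaleR_scaleC\<close> makes the complex scalar multiplication extend the real one,
  so that the norm and topology of the library's real normed spaces can be used.\<close>

class complex_vector = real_vector +
  fixes scaleC :: "complex \<Rightarrow> 'a \<Rightarrow> 'a"  (infixr "*\<^sub>C" 75)
  assumes scaleC_add_right: "c *\<^sub>C (x + y) = c *\<^sub>C x + c *\<^sub>C y"
    and scaleC_add_left: "(c + d) *\<^sub>C x = c *\<^sub>C x + d *\<^sub>C x"
    and scaleC_scaleC: "c *\<^sub>C (d *\<^sub>C x) = (c * d) *\<^sub>C x"
    and scaleR_scaleC: "r *\<^sub>R x = complex_of_real r *\<^sub>C x"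

class complex_normed_vector = complex_vector + real_normed_vector +
  assumes norm_scaleC: "norm (c *\<^sub>C x) = cmod c * norm x"

text \<open>The inner product is conjugate-linear in the first and linear in the second argument.\<close>

class complex_inner = complex_normed_vector +
  fixes cinner :: "'a \<Rightarrow> 'a \<Rightarrow> complex"
  assumes cinner_commute: "cinner x y = cnj (cinner y x)"
    and cinner_add_right: "cinner x (y + z) = cinner x y + cinner x z"
    and cinner_scaleC_right: "cinner x (c *\<^sub>C y) = c * cinner x y"
    and cinner_self: "cinner x x = complex_of_real ((norm x)\<^sup>2)"

class chilbert_space = complex_inner + complete_space

text \<open>Starting from \<open>ring_1\<close> and \<open>real_normed_algebra\<close> rather than \<open>real_normed_algebra_1\<close>
  keeps the zero algebra; otherwise \<open>norm 1 = 1\<close> follows from the C*-identity.\<close>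

class unital_cstar_algebra = complex_normed_vector + complete_space + real_normed_algebra + ring_1 +
  fixes star :: "'a \<Rightarrow> 'a"
  assumes scaleC_mult_left: "(c *\<^sub>C x) * y = c *\<^sub>C (x * y)"
    and scaleC_mult_right: "x * (c *\<^sub>C y) = c *\<^sub>C (x * y)"
    and star_star: "star (star x) = x"
    and star_add: "star (x + y) = star x + star y"
    and star_scaleC: "star (c *\<^sub>C x) = cnj c *\<^sub>C star x"
    and star_mult: "star (x * y) = star y * star x"
    and cstar_identity: "norm (star x * x) = (norm x)\<^sup>2"

instantiation complex :: chilbert_space
begin
definition scaleC_complex :: "complex \<Rightarrow> complex \<Rightarrow> complex" where "scaleC_complex c x = c * x"
definition cinner_complex :: "complex \<Rightarrow> complex \<Rightarrow> complex" where "cinner_complex x y = cnj x * y"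
instance
proof
  fix c d x y z :: complex and r :: real
  show "c *\<^sub>C (x + y) = c *\<^sub>C x + c *\<^sub>C y" "(c + d) *\<^sub>C x = c *\<^sub>C x + d *\<^sub>C x"
    "c *\<^sub>C d *\<^sub>C x = (c * d) *\<^sub>C x"
    by (simp_all add: scaleC_complex_def distrib_left distrib_right)
  show "r *\<^sub>R x = complex_of_real r *\<^sub>C x"
    by (simp add: scaleC_complex_def scaleR_conv_of_real)
  show "norm (c *\<^sub>C x) = cmod c * norm x"
    by (simp add: scaleC_complex_def norm_mult)
  show "cinner x y = cnj (cinner y x)" "cinner x (y + z) = cinner x y + cinner x z"
    "cinner x (c *\<^sub>C y) = c * cinner x y"
    by (simp_all add: cinner_complex_def scaleC_complex_def distrib_left)
  show "cinner x x = complex_of_real ((norm x)\<^sup>2)"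
    unfolding cinner_complex_def complex_norm_square by (rule mult.commute)
qed
end

instantiation complex :: unital_cstar_algebra
begin
definition star_complex :: "complex \<Rightarrow> complex" where "star_complex = cnj"
instance
proof
  fix c x y :: complex
  show "(c *\<^sub>C x) * y = c *\<^sub>C (x * y)" by (simp add: scaleC_complex_def)
  show "x * (c *\<^sub>C y) = c *\<^sub>C (x * y)" by (simp add: scaleC_complex_def)
  show "star (star x) = x" by (simp add: star_complex_def)
  show "star (x + y) = star x + star y" by (simp add: star_complex_def)
  show "star (c *\<^sub>C x) = cnj c *\<^sub>C star x" by (simp add: scaleC_complex_def star_complex_def)
  show "star (x * y) = star y * star x" by (simp add: star_complex_def)
  show "norm (star x * x) = (norm x)\<^sup>2"
    by (simp add: star_complex_def norm_mult power2_eq_square)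
qed
end

section \<open>Bounded operators and adjoints\<close>

abbreviation clinear :: "('a::complex_vector \<Rightarrow> 'b::complex_vector) \<Rightarrow> bool" where
  "clinear \<equiv> Vector_Spaces.linear scaleC scaleC"

abbreviation cspan :: "'a::complex_vector set \<Rightarrow> 'a set" where
  "cspan \<equiv> module.span scaleC"

definition bounded_clinear ::
    "('a::complex_normed_vector \<Rightarrow> 'b::complex_normed_vector) \<Rightarrow> bool" where
  "bounded_clinear f \<longleftrightarrow> clinear f \<and> bounded_linear f"

definition cadjoint :: "('h::chilbert_space \<Rightarrow> 'k::chilbert_space) \<Rightarrow> 'k \<Rightarrow> 'h" where
  "cadjoint T = (SOME S. \<forall>x y. cinner (S y) x = cinner y (T x))"

lemma vector_space_scaleC: "vector_space (scaleC :: complex \<Rightarrow> 'a::complex_vector \<Rightarrow> 'a)"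
proof
  fix x :: 'a
  show "1 *\<^sub>C x = x" using scaleR_scaleC[of 1 x] by simp
qed (simp_all add: scaleC_add_right scaleC_add_left scaleC_scaleC)

lemma clinear_iff:
  "clinear f \<longleftrightarrow> (\<forall>x y. f (x + y) = f x + f y) \<and> (\<forall>c x. f (c *\<^sub>C x) = c *\<^sub>C f x)"
  by (simp add: Vector_Spaces.linear_iff vector_space_scaleC)

lemma norm_add_cinner: "(norm (x + y :: 'a::complex_inner))\<^sup>2 =
    (norm x)\<^sup>2 + 2 * Re (cinner x y) + (norm y)\<^sup>2"
proof -
  have l: "cinner (u + v) w = cinner u w + cinner v w" for u v w :: 'a
    by (metis cinner_add_right cinner_commute complex_cnj_add)
  have "complex_of_real ((norm (x + y))\<^sup>2)
      = cinner x x + cinner x y + (cnj (cinner x y) + cinner y y)"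
    using cinner_self[of "x + y"] cinner_commute[of y x] by (simp add: l cinner_add_right add_ac)
  then have "Re (complex_of_real ((norm (x + y))\<^sup>2))
      = Re (complex_of_real ((norm x)\<^sup>2) + cinner x y
          + (cnj (cinner x y) + complex_of_real ((norm y)\<^sup>2)))"
    by (simp only: cinner_self)
  then show ?thesis by (simp del: of_real_power)
qed

lemma Re_cinner_le: "Re (cinner x y) \<le> norm x * norm (y :: 'a::complex_inner)"
proof -
  have "(norm (x + y))\<^sup>2 \<le> (norm x + norm y)\<^sup>2"
    by (intro power_mono norm_triangle_ineq) simp
  then show ?thesis unfolding norm_add_cinner power2_sum by simp
qed

lemma riesz_representation:
  fixes f :: "'h::chilbert_space \<Rightarrow> complex"
  assumes lin: "clinear f" and bd: "\<And>x. Re (f x) \<le> M * norm x"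
  shows "\<exists>z. \<forall>x. cinner z x = f x"
proof -
  have fadd: "f (x + y) = f x + f y" and fscale: "f (c *\<^sub>C x) = c * f x" for x y c
    using lin by (auto simp: clinear_iff scaleC_complex_def)
  have fR: "f (r *\<^sub>R x) = of_real r * f x" for r x
    by (simp add: scaleR_scaleC fscale)
  have cR: "cinner z (r *\<^sub>R x) = of_real r * cinner z x" for r and z x :: 'h
    by (simp add: scaleR_scaleC cinner_scaleC_right)
  define G where "G x = (norm x)\<^sup>2 - 2 * Re (f x)" for x
  have G_below: "- M\<^sup>2 \<le> G x" for x
  proof -
    have "0 \<le> (norm x - M)\<^sup>2" by simp
    then show ?thesis using bd[of x] unfolding G_def power2_diff by (simp add: algebra_simps)
  qed
  then have bdd: "bdd_below (range G)" unfolding bdd_below_def by blast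
  define m where "m = Inf (range G)"
  have m_le: "m \<le> G x" for x unfolding m_def using bdd by (simp add: cInf_lower)
  have para: "(norm (x - y))\<^sup>2 \<le> 2 * (G x - m) + 2 * (G y - m)" for x y
  proof -
    have neg: "cinner x (- y) = - cinner x y"
      using cR[of x "-1" y] by simp
    have h: "norm ((1/2) *\<^sub>R (x + y)) = norm (x + y) / 2" by simp
    have G_mid: "G ((1/2) *\<^sub>R (x + y)) = (norm (x + y))\<^sup>2 / 4 - Re (f x) - Re (f y)"
      unfolding G_def h by (simp add: fR fadd power2_eq_square add_divide_distrib)
    have "(norm (x + y))\<^sup>2 + (norm (x - y))\<^sup>2 = 2 * (norm x)\<^sup>2 + 2 * (norm y)\<^sup>2"
      using norm_add_cinner[of x y] norm_add_cinner[of x "- y"] by (simp add: neg)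
    moreover have "m \<le> (norm (x + y))\<^sup>2 / 4 - Re (f x) - Re (f y)"
      using m_le[of "(1/2) *\<^sub>R (x + y)"] unfolding G_mid .
    moreover have "d \<le> 2 * (a - 2 * p - m) + 2 * (b - 2 * q - m)"
      if "s + d = 2 * a + 2 * b" "m \<le> s / 4 - p - q" for s d a b p q :: real
      using that by (simp add: field_simps)
    ultimately show ?thesis unfolding G_def by blast
  qed
  have "\<exists>x. G x < m + 1 / real (Suc n)" for n
  proof (rule ccontr)
    assume "\<not> ?thesis"
    then have "m + 1 / real (Suc n) \<le> m"
      unfolding m_def by (intro cInf_greatest) (auto simp: not_less)
    then show False by (simp add: field_simps)
  qed
  then obtain X where X: "\<And>n. G (X n) < m + 1 / real (Suc n)" by metis
  have "Cauchy X"
  proof (rule metric_CauchyI)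
    fix e :: real assume e: "0 < e"
    then obtain N where N: "1 / real (Suc N) < e\<^sup>2 / 4"
      using nat_approx_posE[of "e\<^sup>2 / 4"] by auto
    have "dist (X i) (X j) < e" if "i \<ge> N" "j \<ge> N" for i j
    proof -
      have "1 / real (Suc i) \<le> 1 / real (Suc N)" "1 / real (Suc j) \<le> 1 / real (Suc N)"
        using that by (simp_all add: frac_le)
      then have "(norm (X i - X j))\<^sup>2 < e\<^sup>2"
        using para[of "X i" "X j"] X[of i] X[of j] N by argo
      then show ?thesis using e by (simp add: dist_norm power2_less_imp_less)
    qed
    then show "\<exists>N. \<forall>i\<ge>N. \<forall>j\<ge>N. dist (X i) (X j) < e" by blast
  qed
  then obtain z where z: "X \<longlonglongrightarrow> z" using Cauchy_convergent convergent_def by blast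
  have Gz: "G z = m"
  proof -
    have f_close: "Re (f (X n)) - Re (f z) \<le> M * norm (X n - z)" for n
      using bd[of "X n - z"] fadd[of "X n - z" z] by simp
    have "G z \<le> m"
    proof (rule LIMSEQ_le)
      show "(\<lambda>n. (norm z)\<^sup>2 - 2 * Re (f z)) \<longlonglongrightarrow> G z" by (simp add: G_def)
      have "(\<lambda>n. m + 1 / real (Suc n) + ((norm z)\<^sup>2 - (norm (X n))\<^sup>2) + 2 * (M * norm (X n - z)))
          \<longlonglongrightarrow> m + 0 + ((norm z)\<^sup>2 - (norm z)\<^sup>2) + 2 * (M * norm (z - z))"
        using z by (intro tendsto_intros LIMSEQ_Suc lim_1_over_n)
      then show "(\<lambda>n. m + 1 / real (Suc n) + ((norm z)\<^sup>2 - (norm (X n))\<^sup>2)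
          + 2 * (M * norm (X n - z))) \<longlonglongrightarrow> m" by simp
      show "\<exists>N. \<forall>n\<ge>N. (norm z)\<^sup>2 - 2 * Re (f z)
          \<le> m + 1 / real (Suc n) + ((norm z)\<^sup>2 - (norm (X n))\<^sup>2) + 2 * (M * norm (X n - z))"
      proof (intro exI allI impI)
        fix n show "(norm z)\<^sup>2 - 2 * Re (f z)
          \<le> m + 1 / real (Suc n) + ((norm z)\<^sup>2 - (norm (X n))\<^sup>2) + 2 * (M * norm (X n - z))"
          using X[of n] f_close[of n] unfolding G_def by linarith
      qed
    qed
    then show ?thesis using m_le[of z] by linarith
  qed
  have re: "Re (cinner z x) = Re (f x)" for x
  proof -
    define b where "b = Re (cinner z x) - Re (f x)"
    have q: "0 \<le> 2 * t * b + t\<^sup>2 * (norm x)\<^sup>2" for t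
    proof -
      have "G (z + t *\<^sub>R x) = G z + 2 * t * b + t\<^sup>2 * (norm x)\<^sup>2"
        unfolding G_def norm_add_cinner b_def
        by (simp add: fadd fR cR power_mult_distrib algebra_simps)
      then show ?thesis using m_le[of "z + t *\<^sub>R x"] Gz by linarith
    qed
    define N where "N = (norm x)\<^sup>2 + 1"
    have N: "N > 0" "(norm x)\<^sup>2 < N" unfolding N_def by (auto intro: add_nonneg_pos)
    have "0 \<le> 2 * (- b / N) * b + (- b / N)\<^sup>2 * (norm x)\<^sup>2" by (rule q)
    also have "\<dots> \<le> 2 * (- b / N) * b + (- b / N)\<^sup>2 * N"
      using N by (intro add_left_mono mult_left_mono) auto
    also have "\<dots> = - (b\<^sup>2 / N)" using N by (simp add: field_simps power2_eq_square)
    finally have "b\<^sup>2 \<le> 0" using N by (simp add: field_simps)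
    then show ?thesis unfolding b_def by simp
  qed
  have "cinner z x = f x" for x
  proof (rule complex_eqI)
    show "Im (cinner z x) = Im (f x)"
      using re[of "\<i> *\<^sub>C x"] by (simp add: fscale cinner_scaleC_right)
  qed (rule re)
  then show ?thesis by blast
qed

lemma cinner_cadjoint_left:
  fixes T :: "'h::chilbert_space \<Rightarrow> 'k::chilbert_space"
  assumes "bounded_clinear T"
  shows "cinner (cadjoint T y) x = cinner y (T x)"
proof -
  have lin: "clinear T" and bl: "bounded_linear T"
    using assms by (auto simp: bounded_clinear_def)
  have "\<exists>z. \<forall>x. cinner z x = cinner y (T x)" for y
  proof (rule riesz_representation)
    show "clinear (\<lambda>x. cinner y (T x))"
      using lin by (simp add: clinear_iff cinner_add_right cinner_scaleC_right scaleC_complex_def)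
    show "Re (cinner y (T x)) \<le> (norm y * onorm T) * norm x" for x
      using Re_cinner_le[of y "T x"] mult_left_mono[OF onorm[OF bl, of x], of "norm y"]
      by (simp add: mult.assoc)
  qed
  then have "\<exists>S. \<forall>x y. cinner (S y) x = cinner y (T x)" by metis
  then have "\<forall>x y. cinner (cadjoint T y) x = cinner y (T x)"
    unfolding cadjoint_def by (rule someI_ex)
  then show ?thesis by blast
qed

section \<open>Completely positive maps and Stinespring triples\<close>

text \<open>Linear maps from a complex vector space into the bounded operators on a Hilbert space;
  since operators are added and scaled pointwise, linearity is stated pointwise.\<close>

definition operator_linear ::
    "('a::complex_vector \<Rightarrow> 'h::chilbert_space \<Rightarrow> 'h) \<Rightarrow> bool" where
  "operator_linear \<phi> \<longleftrightarrow> (\<forall>X. bounded_clinear (\<phi> X)) \<and> (\<forall>h. clinear (\<lambda>X. \<phi> X h))"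

text \<open>An \<open>n \<times> n\<close> matrix is a function on pairs of indices \<open>< n\<close>; it is positive in the
  C*-algebra of \<open>n \<times> n\<close> matrices over the given one if it has the form \<open>B* B\<close>, where
  \<open>(B*)\<^sub>i\<^sub>k = (B\<^sub>k\<^sub>i)*\<close>.\<close>

definition positive_matrix ::
    "nat \<Rightarrow> (nat \<Rightarrow> nat \<Rightarrow> 'a::unital_cstar_algebra) \<Rightarrow> bool" where
  "positive_matrix n P \<longleftrightarrow> (\<exists>B. \<forall>i<n. \<forall>j<n. P i j = (\<Sum>k<n. star (B k i) * B k j))"

definition positive_operator_matrix ::
    "nat \<Rightarrow> (nat \<Rightarrow> nat \<Rightarrow> 'h::chilbert_space \<Rightarrow> 'h) \<Rightarrow> bool" where
  "positive_operator_matrix n T \<longleftrightarrow>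
    (\<forall>h. (\<Sum>i<n. \<Sum>j<n. cinner (h i) (T i j (h j))) \<in> \<real>\<^sub>\<ge>\<^sub>0)"

definition completely_positive ::
    "('a::unital_cstar_algebra \<Rightarrow> 'h::chilbert_space \<Rightarrow> 'h) \<Rightarrow> bool" where
  "completely_positive \<phi> \<longleftrightarrow> operator_linear \<phi> \<and>
    (\<forall>n P. positive_matrix n P \<longrightarrow> positive_operator_matrix n (\<lambda>i j. \<phi> (P i j)))"

definition unital_star_representation ::
    "('a::unital_cstar_algebra \<Rightarrow> 'k::chilbert_space \<Rightarrow> 'k) \<Rightarrow> bool" where
  "unital_star_representation \<pi> \<longleftrightarrow> operator_linear \<pi> \<and>
    (\<forall>X Y. \<pi> (X * Y) = \<pi> X \<circ> \<pi> Y) \<and> (\<forall>X. \<pi> (star X) = cadjoint (\<pi> X)) \<and> \<pi> 1 = id"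

definition minimal_stinespring_triple ::
    "('a::unital_cstar_algebra \<Rightarrow> 'h::chilbert_space \<Rightarrow> 'h) \<Rightarrow>
     ('a \<Rightarrow> 'k::chilbert_space \<Rightarrow> 'k) \<Rightarrow> ('h \<Rightarrow> 'k) \<Rightarrow> bool" where
  "minimal_stinespring_triple \<phi> \<pi> V \<longleftrightarrow>
    unital_star_representation \<pi> \<and> bounded_clinear V \<and>
    (\<forall>X. \<phi> X = cadjoint V \<circ> \<pi> X \<circ> V) \<and>
    closure (cspan {\<pi> X (V h) | X h. True}) = UNIV"

definition cyclic_vector ::
    "('a::unital_cstar_algebra \<Rightarrow> 'k::chilbert_space \<Rightarrow> 'k) \<Rightarrow> 'k \<Rightarrow> bool" where
  "cyclic_vector \<pi> g \<longleftrightarrow> closure (cspan (range (\<lambda>X. \<pi> X g))) = UNIV"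

text \<open>HOL cannot quantify over the type carrying the Stinespring space, so it is a parameter.
  Minimal Stinespring triples are unique up to unitary equivalence and cyclicity is invariant
  under such equivalence, so the choice of the triple is immaterial. A theorem with the
  hypothesis \<open>quasi_pure TYPE('k) \<phi>\<close> for a type variable \<open>'k\<close> thus applies whichever Hilbert
  space realizes the triple.\<close>

definition quasi_pure ::
    "'k::chilbert_space itself \<Rightarrow> ('a::unital_cstar_algebra \<Rightarrow> 'h::chilbert_space \<Rightarrow> 'h) \<Rightarrow> bool" where
  "quasi_pure _ \<phi> \<longleftrightarrow> (\<exists>(\<pi> :: 'a \<Rightarrow> 'k \<Rightarrow> 'k) V. minimal_stinespring_triple \<phi> \<pi> V \<and>
    (\<forall>g\<in>range V. g \<noteq> 0 \<longrightarrow> cyclic_vector \<pi> g))"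

end

theory Submission
  imports Defs
begin

text \<open>
  Fix \<open>h\<close> with \<open>V (R h) \<noteq> 0\<close>, where \<open>(\<pi>, V)\<close> is a Stinespring pair of \<open>\<phi>\<close>, and put \<open>g = R h\<close>.
  Quasi-purity makes \<open>V g\<close> cyclic, so every \<open>V k\<close> is a limit of vectors \<open>\<pi> Y (V g)\<close>. The
  squared distance between \<open>V k\<close> and \<open>\<pi> Y (V g)\<close> expands into
  \<open>\<langle>k, \<phi> 1 k\<rangle> - 2 Re \<langle>k, \<phi> Y g\<rangle> + \<langle>g, \<phi> (Y* Y) g\<rangle>\<close>,
  which involves only \<open>\<phi> 1\<close> and values of \<open>\<phi>\<close> on the range of \<open>R\<close>. By hypothesis \<open>\<psi>\<close> has the
  same values there, so in the Stinespring space of \<open>\<psi>\<close> the vector \<open>k\<close> is approximated just as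
  well by the same \<open>Y\<close>. Applying an algebra element \<open>X\<close> on both sides, \<open>\<phi> X k\<close> and \<open>\<psi> X k\<close> are
  approximated, weakly, by \<open>\<phi> (X Y) g\<close> and \<open>\<psi> (X Y) g\<close>, and these two vectors agree.

  No Stinespring space of \<open>\<psi>\<close> is constructed: the squared distance above, here
  \<open>stinespring_dist2\<close>, is read off from the map itself, and the weak approximation is the
  Cauchy--Schwarz inequality \<open>completely_positive_cauchy_schwarz\<close> of the positive semidefinite form
  \<open>(X \<otimes> h, Y \<otimes> k) \<mapsto> \<langle>h, \<theta> (X* Y) k\<rangle>\<close>. For \<open>\<phi>\<close>, the lemma
  \<open>stinespring_dist2_eq_norm\<close> identifies it with a distance in the given Hilbert space.
\<close>

lemma scaleC_zero_left: "0 *\<^sub>C x = (0 :: 'a::complex_vector)"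
  using scaleR_scaleC[of 0 x] by simp

lemma scaleC_minus_one: "(-1) *\<^sub>C x = - (x :: 'a::complex_vector)"
  using scaleR_scaleC[of "-1" x] by simp

lemma cinner_add_left: "cinner (x + y) z = cinner x z + cinner (y :: 'a::complex_inner) z"
  by (metis cinner_add_right cinner_commute complex_cnj_add)

lemma cinner_scaleC_left: "cinner (c *\<^sub>C x) y = cnj c * cinner (x :: 'a::complex_inner) y"
  by (metis cinner_commute cinner_scaleC_right complex_cnj_mult)

lemma cinner_scaleR_left: "cinner (r *\<^sub>R x) y = of_real r * cinner (x :: 'a::complex_inner) y"
  by (simp add: scaleR_scaleC cinner_scaleC_left)

lemma cinner_scaleR_right: "cinner x (r *\<^sub>R y) = of_real r * cinner (x :: 'a::complex_inner) y"
  by (simp add: scaleR_scaleC cinner_scaleC_right)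

lemma cinner_minus_left: "cinner (- x) y = - cinner (x :: 'a::complex_inner) y"
  using cinner_scaleR_left[of "-1" x y] by simp

lemma cinner_minus_right: "cinner x (- y) = - cinner (x :: 'a::complex_inner) y"
  using cinner_scaleR_right[of x "-1" y] by simp

lemma cinner_zero_left: "cinner 0 x = (0 :: complex)" for x :: "'a::complex_inner"
  using cinner_scaleR_left[of 0 x x] by simp

lemma cinner_diff_right: "cinner x (y - z) = cinner x y - cinner (x :: 'a::complex_inner) z"
  using cinner_add_right[of x y "- z"] by (simp add: cinner_minus_right)

lemma cinner_self_Re: "Re (cinner x x) = (norm (x :: 'a::complex_inner))\<^sup>2"
  by (simp add: cinner_self)

lemma star_one: "star 1 = (1 :: 'a::unital_cstar_algebra)"
  using star_mult[of "star 1" "1 :: 'a"] by (simp add: star_star)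

lemma star_zero: "star 0 = (0 :: 'a::unital_cstar_algebra)"
  using star_scaleC[of 0 "0 :: 'a"] by (simp add: scaleC_zero_left)

lemma bounded_clinear_scaleC: "bounded_clinear T \<Longrightarrow> T (c *\<^sub>C x) = c *\<^sub>C T x"
  by (simp add: bounded_clinear_def clinear_iff)

lemma bounded_clinear_minus: "bounded_clinear T \<Longrightarrow> T (- x) = - T x"
  using bounded_clinear_scaleC[of T "-1" x] by (simp add: scaleC_minus_one)

lemma bounded_clinear_scaleR: "bounded_clinear T \<Longrightarrow> T (r *\<^sub>R x) = r *\<^sub>R T x"
  by (simp add: bounded_clinear_scaleC scaleR_scaleC)

lemma bounded_clinear_zero: "bounded_clinear T \<Longrightarrow> T 0 = 0"
  using bounded_clinear_scaleC[of T 0 0] by (simp add: scaleC_zero_left)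

lemma cinner_cadjoint_right:
  fixes T :: "'h::chilbert_space \<Rightarrow> 'k::chilbert_space"
  assumes "bounded_clinear T"
  shows "cinner x (cadjoint T y) = cinner (T x) y"
  using cinner_cadjoint_left[OF assms, of y x] by (metis cinner_commute)

lemma cadjoint_zero:
  fixes T :: "'h::chilbert_space \<Rightarrow> 'k::chilbert_space"
  assumes "bounded_clinear T"
  shows "cadjoint T 0 = 0"
proof -
  have "cinner (cadjoint T 0) (cadjoint T 0) = 0"
    by (simp add: cinner_cadjoint_left[OF assms] cinner_zero_left)
  then show ?thesis by (simp add: cinner_self)
qed

lemma completely_positive_bounded_clinear:
  "completely_positive \<theta> \<Longrightarrow> bounded_clinear (\<theta> X)"
  by (simp add: completely_positive_def operator_linear_def)

text \<open>The matrix with entries \<open>X\<^sub>i* X\<^sub>j\<close> is positive, being \<open>B* B\<close> for the matrix \<open>B\<close> whose first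
  row is \<open>X\<close> and whose other rows vanish.\<close>

lemma completely_positive_form_nonneg:
  fixes \<theta> :: "'a::unital_cstar_algebra \<Rightarrow> 'h::chilbert_space \<Rightarrow> 'h" and n :: nat
  assumes "completely_positive \<theta>"
  shows "(\<Sum>i<n. \<Sum>j<n. cinner (h i) (\<theta> (star (X i) * X j) (h j))) \<in> \<real>\<^sub>\<ge>\<^sub>0"
proof -
  have "star (X i) * X j
      = (\<Sum>k<n. star (if k = 0 then X i else 0) * (if k = 0 then X j else 0))"
    if "i < n" for i j
  proof -
    have "(\<Sum>k<n. star (if k = 0 then X i else 0) * (if k = 0 then X j else 0))
        = (\<Sum>k<n. if k = 0 then star (X i) * X j else 0)"
      by (rule sum.cong) (auto simp: star_zero)
    then show ?thesis using that by (simp add: sum.delta)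
  qed
  then have "positive_matrix n (\<lambda>i j. star (X i) * X j)"
    unfolding positive_matrix_def by (intro exI[of _ "\<lambda>k i. if k = 0 then X i else 0"]) blast
  then show ?thesis
    using assms unfolding completely_positive_def positive_operator_matrix_def by blast
qed

text \<open>The form is real on the diagonal; polarization over the pairs \<open>1 \<otimes> u + X \<otimes> v\<close> and
  \<open>1 \<otimes> u + X \<otimes> \<i> v\<close> turns this into symmetry under the adjoint.\<close>

lemma completely_positive_hermitian:
  fixes \<theta> :: "'a::unital_cstar_algebra \<Rightarrow> 'h::chilbert_space \<Rightarrow> 'h"
  assumes "completely_positive \<theta>"
  shows "cinner v (\<theta> (star X) u) = cnj (cinner u (\<theta> X v))"
proof -
  note lin = completely_positive_bounded_clinear[OF assms]
  have diag: "Im (cinner w (\<theta> (star Z * Z) w)) = 0" for w Z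
    using completely_positive_form_nonneg[OF assms, of "\<lambda>_. w" "\<lambda>_. Z" 1]
    by (simp add: complex_nonneg_Reals_iff)
  have cross: "Im (cinner u (\<theta> X w)) + Im (cinner w (\<theta> (star X) u)) = 0" for w
    using completely_positive_form_nonneg[OF assms,
        of "\<lambda>i. if i = 0 then u else w" "\<lambda>i. if i = 0 then 1 else X" 2]
      diag[of u 1] diag[of w X]
    by (simp add: complex_nonneg_Reals_iff numeral_2_eq_2 star_one)
  show ?thesis
    using cross[of v] cross[of "\<i> *\<^sub>C v"]
    by (simp add: complex_eq_iff bounded_clinear_scaleC[OF lin] cinner_scaleC_left
        cinner_scaleC_right)
qed

text \<open>In terms of a Stinespring pair \<open>(\<rho>, W)\<close> of \<open>\<theta>\<close> this is the square of the norm of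
  \<open>W k - \<rho> Y (W g)\<close>, written without reference to that pair.\<close>

definition stinespring_dist2 ::
    "('a::unital_cstar_algebra \<Rightarrow> 'h::chilbert_space \<Rightarrow> 'h) \<Rightarrow> 'h \<Rightarrow> 'a \<Rightarrow> 'h \<Rightarrow> real" where
  "stinespring_dist2 \<theta> k Y g =
    Re (cinner k (\<theta> 1 k)) - 2 * Re (cinner k (\<theta> Y g)) + Re (cinner g (\<theta> (star Y * Y) g))"

lemma nonneg_quadratic_discriminant:
  fixes a c d :: real
  assumes "0 \<le> a" and q: "\<And>s. 0 \<le> a * s\<^sup>2 + 2 * c * s + d"
  shows "c\<^sup>2 \<le> a * d"
proof (cases "a = 0")
  case True
  have "c = 0"
  proof (rule ccontr)
    assume "c \<noteq> 0"
    then show False using q[of "- (d + 1) / (2 * c)"] True by (simp add: field_simps)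
  qed
  then show ?thesis using True by simp
next
  case False
  then have "0 < a" using assms(1) by simp
  then show ?thesis using q[of "- c / a"] by (simp add: field_simps power2_eq_square)
qed

text \<open>In Stinespring terms this is the Cauchy--Schwarz inequality for \<open>\<rho> (X*) (W l)\<close> and
  \<open>W k - \<rho> Y (W g)\<close>. It comes from positivity of the form at
  \<open>X* \<otimes> s l + 1 \<otimes> k - Y \<otimes> g\<close> for all real \<open>s\<close>.\<close>

lemma completely_positive_cauchy_schwarz:
  fixes \<theta> :: "'a::unital_cstar_algebra \<Rightarrow> 'h::chilbert_space \<Rightarrow> 'h"
  assumes "completely_positive \<theta>"
  shows "(Re (cinner l (\<theta> X k - \<theta> (X * Y) g)))\<^sup>2
    \<le> Re (cinner l (\<theta> (X * star X) l)) * stinespring_dist2 \<theta> k Y g"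
proof (rule nonneg_quadratic_discriminant)
  note lin = completely_positive_bounded_clinear[OF assms]
  note herm = completely_positive_hermitian[OF assms]
  show "0 \<le> Re (cinner l (\<theta> (X * star X) l))"
    using completely_positive_form_nonneg[OF assms, of "\<lambda>_. l" "\<lambda>_. star X" 1]
    by (simp add: complex_nonneg_Reals_iff star_star)
  fix s :: real
  let ?h = "\<lambda>i::nat. if i = 0 then s *\<^sub>R l else if i = 1 then k else - g"
  let ?Z = "\<lambda>i::nat. if i = 0 then star X else if i = 1 then 1 else Y"
  have lk: "Re (cinner k (\<theta> (star X) l)) = Re (cinner l (\<theta> X k))"
    and lg: "Re (cinner g (\<theta> (star Y * star X) l)) = Re (cinner l (\<theta> (X * Y) g))"
    and kg: "Re (cinner g (\<theta> (star Y) k)) = Re (cinner k (\<theta> Y g))"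
    using herm[of k X l] herm[of g "X * Y" l] herm[of g Y k] by (simp_all add: star_mult)
  have "0 \<le> Re (\<Sum>i<3. \<Sum>j<3. cinner (?h i) (\<theta> (star (?Z i) * ?Z j) (?h j)))"
    using completely_positive_form_nonneg[OF assms, of ?h ?Z 3]
    by (simp only: complex_nonneg_Reals_iff)
  then show "0 \<le> Re (cinner l (\<theta> (X * star X) l)) * s\<^sup>2
      + 2 * Re (cinner l (\<theta> X k - \<theta> (X * Y) g)) * s + stinespring_dist2 \<theta> k Y g"
    by (simp add: numeral_3_eq_3 star_star star_one bounded_clinear_scaleR[OF lin]
        bounded_clinear_minus[OF lin] cinner_scaleR_left cinner_scaleR_right cinner_minus_left
        cinner_minus_right cinner_diff_right stinespring_dist2_def lk lg kg
        algebra_simps power2_eq_square)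
qed

lemma stinespring_dist2_eq_norm:
  fixes \<phi> :: "'a::unital_cstar_algebra \<Rightarrow> 'h::chilbert_space \<Rightarrow> 'h"
    and \<pi> :: "'a \<Rightarrow> 'k::chilbert_space \<Rightarrow> 'k"
  assumes "unital_star_representation \<pi>" and V: "bounded_clinear V"
    and \<phi>: "\<And>X. \<phi> X = cadjoint V \<circ> \<pi> X \<circ> V"
  shows "stinespring_dist2 \<phi> k Y g = (norm (V k - \<pi> Y (V g)))\<^sup>2"
proof -
  have \<pi>: "bounded_clinear (\<pi> Y)" "\<pi> (star Y * Y) = cadjoint (\<pi> Y) \<circ> \<pi> Y" "\<pi> 1 = id"
    using assms(1) by (auto simp: unital_star_representation_def operator_linear_def)
  have "stinespring_dist2 \<phi> k Y g
      = (norm (V k))\<^sup>2 - 2 * Re (cinner (V k) (\<pi> Y (V g))) + (norm (\<pi> Y (V g)))\<^sup>2"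
    by (simp add: stinespring_dist2_def \<phi> cinner_cadjoint_right[OF V] \<pi>(2,3)
        cinner_cadjoint_right[OF \<pi>(1)] cinner_self_Re)
  also have "\<dots> = (norm (V k + - \<pi> Y (V g)))\<^sup>2"
    by (simp only: norm_add_cinner cinner_minus_right norm_minus_cancel) simp
  finally show ?thesis by simp
qed

text \<open>The orbit of a vector under the representation is already a subspace, so its closed span is
  its closure.\<close>

lemma cyclic_vector_approx:
  fixes \<pi> :: "'a::unital_cstar_algebra \<Rightarrow> 'k::chilbert_space \<Rightarrow> 'k"
  assumes "unital_star_representation \<pi>" and "cyclic_vector \<pi> g" and "0 < e"
  shows "\<exists>Y. norm (x - \<pi> Y g) < e"
proof -
  interpret cv: vector_space "scaleC :: complex \<Rightarrow> 'k \<Rightarrow> 'k" by (rule vector_space_scaleC)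
  have lin: "clinear (\<lambda>X. \<pi> X g)"
    using assms(1) by (simp add: unital_star_representation_def operator_linear_def)
  then have add: "\<pi> (X + Y) g = \<pi> X g + \<pi> Y g" and scale: "\<pi> (c *\<^sub>C X) g = c *\<^sub>C \<pi> X g" for X Y c
    by (simp_all add: clinear_iff)
  have "cv.subspace (range (\<lambda>X. \<pi> X g))"
    unfolding cv.subspace_def
  proof (intro conjI ballI allI)
    show "0 \<in> range (\<lambda>X. \<pi> X g)" using scale[of 0 0] by (auto simp: scaleC_zero_left)
  qed (auto simp flip: add scale)
  then have "cspan (range (\<lambda>X. \<pi> X g)) = range (\<lambda>X. \<pi> X g)"
    by (simp only: cv.span_eq_iff)
  then have "x \<in> closure (range (\<lambda>X. \<pi> X g))"
    using assms(2) unfolding cyclic_vector_def by (metis UNIV_I)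
  then show ?thesis
    using assms(3) unfolding closure_approachable by (auto simp: dist_norm norm_minus_commute)
qed

theorem theorem4p3:
  fixes \<phi> \<psi> :: "'a::unital_cstar_algebra \<Rightarrow> 'h::chilbert_space \<Rightarrow> 'h"
    and R :: "'h \<Rightarrow> 'h"
  assumes "completely_positive \<phi>" and "completely_positive \<psi>"
    and "quasi_pure TYPE('k::chilbert_space) \<phi>"
    and "\<phi> 1 = \<psi> 1"
    and "bounded_clinear R"
    and "\<forall>X. \<phi> X \<circ> R = \<psi> X \<circ> R"
    and "\<exists>X\<^sub>0. \<phi> X\<^sub>0 \<circ> R \<noteq> (\<lambda>h. 0)"
  shows "\<phi> = \<psi>"
proof (intro ext)
  fix X k
  obtain \<pi> :: "'a \<Rightarrow> 'k \<Rightarrow> 'k" and V where triple: "minimal_stinespring_triple \<phi> \<pi> V"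
    and cyc: "\<And>g. g \<in> range V \<Longrightarrow> g \<noteq> 0 \<Longrightarrow> cyclic_vector \<pi> g"
    using assms(3) unfolding quasi_pure_def by blast
  have rep: "unital_star_representation \<pi>" and V: "bounded_clinear V"
    and \<phi>: "\<And>X. \<phi> X = cadjoint V \<circ> \<pi> X \<circ> V"
    using triple by (auto simp: minimal_stinespring_triple_def)
  obtain X\<^sub>0 h where X\<^sub>0: "\<phi> X\<^sub>0 (R h) \<noteq> 0" using assms(7) by (auto simp: fun_eq_iff)
  define g where "g = R h"
  have "bounded_clinear (\<pi> X\<^sub>0)"
    using rep by (simp add: unital_star_representation_def operator_linear_def)
  then have "V g \<noteq> 0"
    using X\<^sub>0 by (auto simp: g_def \<phi> bounded_clinear_zero cadjoint_zero[OF V])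
  then have cyclic: "cyclic_vector \<pi> (V g)" using cyc by blast
  have agree: "\<phi> Z g = \<psi> Z g" for Z
    using assms(6) unfolding g_def by (metis comp_apply)
  have dist_agree: "stinespring_dist2 \<psi> k Y g = stinespring_dist2 \<phi> k Y g" for Y
    by (simp add: stinespring_dist2_def agree assms(4))
  \<comment> \<open>Testing against the difference itself turns the weak estimate into a bound on its norm.\<close>
  define l where "l = \<phi> X k - \<psi> X k"
  define M where "M = 2 * Re (cinner l (\<phi> (X * star X) l)) + 2 * Re (cinner l (\<psi> (X * star X) l))"
  have bound: "((norm l)\<^sup>2)\<^sup>2 \<le> M * stinespring_dist2 \<phi> k Y g" for Y
  proof -
    define p where "p = Re (cinner l (\<phi> X k - \<phi> (X * Y) g))"
    define q where "q = Re (cinner l (\<psi> X k - \<psi> (X * Y) g))"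
    have "(norm l)\<^sup>2 = p - q"
      using cinner_self_Re[of l] by (simp add: p_def q_def cinner_diff_right agree l_def)
    then have "((norm l)\<^sup>2)\<^sup>2 = (p - q)\<^sup>2" by simp
    also have "\<dots> \<le> 2 * p\<^sup>2 + 2 * q\<^sup>2"
      using zero_le_power2[of "p + q"] unfolding power2_sum power2_diff by linarith
    also have "\<dots> \<le> M * stinespring_dist2 \<phi> k Y g"
      using completely_positive_cauchy_schwarz[OF assms(1), of l X k Y g]
        completely_positive_cauchy_schwarz[OF assms(2), of l X k Y g]
      unfolding p_def q_def M_def dist_agree by (simp add: algebra_simps)
    finally show ?thesis .
  qed
  have "((norm l)\<^sup>2)\<^sup>2 \<le> 0"
  proof (rule field_le_epsilon)
    fix e :: real assume e: "0 < e"
    \<comment> \<open>Enlarging \<open>M\<close> to \<open>\<bar>M\<bar> + 1\<close> avoids a zero denominator.\<close>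
    define d where "d = sqrt (e / (\<bar>M\<bar> + 1))"
    have d: "0 < d" "(\<bar>M\<bar> + 1) * d\<^sup>2 = e" using e by (simp_all add: d_def add_nonneg_pos)
    obtain Y where Y: "norm (V k - \<pi> Y (V g)) < d"
      using cyclic_vector_approx[OF rep cyclic d(1)] by blast
    have "((norm l)\<^sup>2)\<^sup>2 \<le> M * (norm (V k - \<pi> Y (V g)))\<^sup>2"
      using bound[of Y] by (simp only: stinespring_dist2_eq_norm[of \<pi> V \<phi>, OF rep V \<phi>])
    also have "\<dots> \<le> (\<bar>M\<bar> + 1) * d\<^sup>2"
      using Y by (intro mult_mono power_mono) auto
    finally show "((norm l)\<^sup>2)\<^sup>2 \<le> 0 + e" using d(2) by simp
  qed
  then show "\<phi> X k = \<psi> X k" by (simp add: l_def)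
qed

end
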